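(* Let $(X,d)$ be a finite metric space, $\mathcal F$ a class of clusterings of $X$, $\lambda$ a threshold parameter, $\epsilon,\delta\in(0,1)$, and $C^*$ a target clustering of $X$ accessible through a same-cluster oracle. Let $d$ be $(\alpha,\beta)$-informative with respect to $\lambda$ and $C^*$, and let $X$ be $\gamma$-skewed with respect to $C^*$. Let $\mathcal A$ be the empirical risk minimization algorithm described in the context, run with sample sizes $m_+$ and $m_-$ satisfying $$m_-,\,m_+\ \ge\ a\,\frac{\mathrm{VCDim}(\mathcal F)+\log(2/\delta)}{\epsilon^2},$$ where $a$ is a global constant. Then, for a parameter $\nu$, with probability at least $$1-\exp\Big(-\frac{\nu^2m_-}{4}\Big)-\exp\Big(-\frac{\nu^2m_+}{4}\Big)$$ over the randomness in the sampling procedure, the number $q$ of same-cluster queries made by $\mathcal A$ satisfies $$q\ \le\ (1+\nu)\Big(\frac{m_-}{1-\gamma}+\frac{m_+}{\beta}\Big).$$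
   Context: Let $X^{[2]}=\{(x,y)\in X\times X:x\ne y\}$ and let $U^2$ be the uniform distribution on $X^{[2]}$. A clustering (partition) $C$ of $X$ is viewed as a function $C:X^{[2]}\to\{0,1\}$ with $C(x,y)=1$ iff $x,y$ lie in the same cluster; $\mathrm{VCDim}(\mathcal F)$ is the VC-dimension of $\mathcal F$ as a class of such functions. A same-cluster $C^*$-oracle, given $x,y$, returns $1$ if they are in the same $C^*$-cluster and $0$ otherwise; each call is one same-cluster query. $d$ is $(\alpha,\beta)$-informative w.r.t. $C^*$ and $\lambda$ if $\mathbf P_{(x,y)\sim U^2}[d(x,y)>\lambda\mid C^*(x,y)=1]\le\alpha$ and $\mathbf P_{(x,y)\sim U^2}[C^*(x,y)=1\mid d(x,y)\le\lambda]\ge\beta$. $X$ is $\gamma$-skewed w.r.t. $C^*$ if $\mathbf P_{(x,y)\sim U^2}[C^*(x,y)=1]\le\gamma$. Procedure $\mathcal P_0$ (negative pairs): repeatedly draw $(x,y)\sim U^2$ and query the oracle on $(x,y)$, until a pair with $C^*(x,y)=0$ is drawn; output that pair. Procedure $\mathcal P_{11}$ (positive pairs, output in $X^{[2]}$): for each $x\in X$ let $S_x=\{y\in X: y\ne x,\ d(x,y)\le\lambda\}$. Repeatedly draw $x\in X$ with probability proportional to $|S_x|$, then $y$ uniformly from $S_x$, and query the oracle on $(x,y)$, until $C^*(x,y)=1$; output that pair. Algorithm $\mathcal A$ (ERM): draw a sample $S_+$ of size $m_+$ using $\mathcal P_{11}$ and a sample $S_-$ of size $m_-$ using $\mathcal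 P_0$; then output a clustering in $\mathcal F$ minimizing $\mu\hat E(C)+(1-\mu)\hat G(C)$, where $\hat E(C)$ is the fraction of pairs in $S_+$ with $C(x,y)=0$, $\hat G(C)$ is the fraction of pairs in $S_-$ with $C(x,y)=1$, and $\mu=\frac{w_1\gamma_0}{w_1\gamma_0+w_2(1-\gamma_0)}$ with $\gamma_0=\mathbf P_{(x,y)\sim U^2}[C^*(x,y)=1]$ and given weights $w_1,w_2$.
   Formalization: The parameter ν is restricted to 0 < ν ≤ 1, since for large ν the stated bound fails (geometric tails decay only exponentially in ν, not like exp(−ν²m/4)); β > 0 and γ < 1 are assumed so that the bound on q is meaningful. *)

theory Defs
  imports "HOL-Probability.Probability" "HOL-Library.Disjoint_Sets"
begin

definition distinct_pairs :: "'a set \<Rightarrow> ('a \<times> 'a) set" where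
  "distinct_pairs X = {(x, y). x \<in> X \<and> y \<in> X \<and> x \<noteq> y}"

(* Junk value if X has fewer than two elements. *)
definition U2 :: "'a set \<Rightarrow> ('a \<times> 'a) pmf" where
  "U2 X = pmf_of_set (distinct_pairs X)"

(* A clustering of X is a set C of blocks with partition_on X C. The {0,1}-valued function
   on pairs attached to C is rendered as a predicate, True standing for 1. *)
definition same_cluster :: "'a set set \<Rightarrow> 'a \<times> 'a \<Rightarrow> bool" where
  "same_cluster C = (\<lambda>(x, y). \<exists>A\<in>C. x \<in> A \<and> y \<in> A)"

definition shatters :: "('b \<Rightarrow> bool) set \<Rightarrow> 'b set \<Rightarrow> bool" where
  "shatters H S \<longleftrightarrow> (\<forall>T\<subseteq>S. \<exists>h\<in>H. \<forall>z\<in>S. h z \<longleftrightarrow> z \<in> T)"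

(* Only meaningful for a finite domain D and a nonempty class H; then the set below is
   finite and contains 0. *)
definition vc_dim :: "'b set \<Rightarrow> ('b \<Rightarrow> bool) set \<Rightarrow> nat" where
  "vc_dim D H = Max {card S | S. S \<subseteq> D \<and> shatters H S}"

definition clustering_vc_dim :: "'a set \<Rightarrow> 'a set set set \<Rightarrow> nat" where
  "clustering_vc_dim X F = vc_dim (distinct_pairs X) (same_cluster ` F)"

definition positive_prob :: "'a set \<Rightarrow> 'a set set \<Rightarrow> real" where
  "positive_prob X C = \<P>(p in measure_pmf (U2 X). same_cluster C p)"

(* The library's conditional probability is 0 when the conditioning event is null. *)
definition informative ::
  "'a set \<Rightarrow> ('a \<Rightarrow> 'a \<Rightarrow> real) \<Rightarrow> real \<Rightarrow> 'a set set \<Rightarrow> real \<Rightarrow> real \<Rightarrow> bool" where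
  "informative X d lam C \<alpha> \<beta> \<longleftrightarrow>
     \<P>(p in measure_pmf (U2 X). d (fst p) (snd p) > lam \<bar> same_cluster C p) \<le> \<alpha> \<and>
     \<P>(p in measure_pmf (U2 X). same_cluster C p \<bar> d (fst p) (snd p) \<le> lam) \<ge> \<beta>"

definition skewed :: "'a set \<Rightarrow> 'a set set \<Rightarrow> real \<Rightarrow> bool" where
  "skewed X C \<gamma> \<longleftrightarrow> positive_prob X C \<le> \<gamma>"

(* Draw from D and make one query per draw until the answer is accepted; return the accepted
   element with the number of queries made. Non-termination is the missing mass of the
   subprobability distribution. *)
partial_function (spmf) draw_until :: "'b spmf \<Rightarrow> ('b \<Rightarrow> bool) \<Rightarrow> ('b \<times> nat) spmf" where
  "draw_until D accept =
     do {
       z \<leftarrow> D;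
       if accept z then return_spmf (z, 1)
       else do {
         (w, n) \<leftarrow> draw_until D accept;
         return_spmf (w, n + 1)
       }
     }"

definition P0 :: "'a set \<Rightarrow> 'a set set \<Rightarrow> (('a \<times> 'a) \<times> nat) spmf" where
  "P0 X Cstar = draw_until (spmf_of_pmf (U2 X)) (\<lambda>p. \<not> same_cluster Cstar p)"

definition near :: "'a set \<Rightarrow> ('a \<Rightarrow> 'a \<Rightarrow> real) \<Rightarrow> real \<Rightarrow> 'a \<Rightarrow> 'a set" where
  "near X d lam x = {y \<in> X. y \<noteq> x \<and> d x y \<le> lam}"

(* If near X d lam x is empty for every x in X, the first step fails, i.e. the procedure produces nothing. *)
definition near_pair :: "'a set \<Rightarrow> ('a \<Rightarrow> 'a \<Rightarrow> real) \<Rightarrow> real \<Rightarrow> ('a \<times> 'a) spmf" where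
  "near_pair X d lam =
     do {
       x \<leftarrow> embed_spmf (\<lambda>x. if x \<in> X
              then real (card (near X d lam x)) / (\<Sum>z\<in>X. real (card (near X d lam z))) else 0);
       y \<leftarrow> spmf_of_set (near X d lam x);
       return_spmf (x, y)
     }"

definition P11 ::
  "'a set \<Rightarrow> ('a \<Rightarrow> 'a \<Rightarrow> real) \<Rightarrow> real \<Rightarrow> 'a set set \<Rightarrow> (('a \<times> 'a) \<times> nat) spmf" where
  "P11 X d lam Cstar = draw_until (near_pair X d lam) (same_cluster Cstar)"

(* Independent repetition of a sampling procedure, adding up the query counts. *)
primrec draw_sample :: "nat \<Rightarrow> ('b \<times> nat) spmf \<Rightarrow> ('b list \<times> nat) spmf" where
  "draw_sample 0 P = return_spmf ([], 0)"
| "draw_sample (Suc m) P =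
     do {
       (z, k) \<leftarrow> P;
       (zs, n) \<leftarrow> draw_sample m P;
       return_spmf (z # zs, k + n)
     }"

definition fraction :: "('b \<Rightarrow> bool) \<Rightarrow> 'b list \<Rightarrow> real" where
  "fraction Q S = real (length (filter Q S)) / real (length S)"

definition erm_weight :: "real \<Rightarrow> real \<Rightarrow> real \<Rightarrow> real" where
  "erm_weight w1 w2 g = w1 * g / (w1 * g + w2 * (1 - g))"

definition empirical_loss ::
  "real \<Rightarrow> ('a \<times> 'a) list \<Rightarrow> ('a \<times> 'a) list \<Rightarrow> 'a set set \<Rightarrow> real" where
  "empirical_loss \<mu> Sp Sm C =
     \<mu> * fraction (\<lambda>p. \<not> same_cluster C p) Sp + (1 - \<mu>) * fraction (\<lambda>p. same_cluster C p) Sm"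

(* Output: the chosen clustering together with the total number of same-cluster queries. *)
definition ERM ::
  "'a set \<Rightarrow> ('a \<Rightarrow> 'a \<Rightarrow> real) \<Rightarrow> real \<Rightarrow> 'a set set \<Rightarrow> 'a set set set \<Rightarrow> real \<Rightarrow> real
     \<Rightarrow> nat \<Rightarrow> nat \<Rightarrow> ('a set set \<times> nat) spmf" where
  "ERM X d lam Cstar F w1 w2 mp mm =
     do {
       (Sp, qp) \<leftarrow> draw_sample mp (P11 X d lam Cstar);
       (Sm, qm) \<leftarrow> draw_sample mm (P0 X Cstar);
       return_spmf
         (arg_min_on (empirical_loss (erm_weight w1 w2 (positive_prob X Cstar)) Sp Sm) F,
          qp + qm)
     }"

end

theory Submission
  imports Defs
begin

text \<open>
  Each sampling procedure repeats independent trials whose success probability is at least some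
  \<open>p\<close>: \<open>1 - \<gamma>\<close> for the negative pairs, and \<open>\<beta>\<close> for the positive ones, since there the proposals are
  uniform on the pairs at distance at most \<open>lam\<close>. Conditioning on the first trial and \<open>1 - t \<le> exp (- t)\<close>
  bound the moment generating function at \<open>t < p\<close> of the number of queries for one pair by
  \<open>p / (p - t)\<close>. For \<open>m\<close> pairs, Markov's inequality with \<open>t = p \<nu> / (1 + \<nu>)\<close> bounds the probability of
  more than \<open>(1 + \<nu>) m / p\<close> queries by \<open>exp (- m (\<nu> - ln (1 + \<nu>)))\<close>, where \<open>\<nu> - ln (1 + \<nu>) \<ge> \<nu>\<^sup>2 / 4\<close> as
  \<open>\<nu> \<le> 1\<close>. A union bound over the two samples finishes the proof.
\<close>

section \<open>One rejection loop: first-draw recursion, termination, exponential moment\<close>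

lemma nn_integral_bind_spmf:
  "nn_integral (measure_spmf (p \<bind> f)) g = (\<integral>\<^sup>+ x. nn_integral (measure_spmf (f x)) g \<partial>measure_spmf p)"
  unfolding measure_spmf_bind
  by (subst nn_integral_bind[where B = "count_space UNIV"])
     (auto simp: o_def space_subprob_algebra intro!: measurable_measure_spmf)

lemma emeasure_space_lossless_spmf:
  "lossless_spmf p \<Longrightarrow> emeasure (measure_spmf p) (space (measure_spmf p)) = 1"
  by (simp add: space_measure_spmf measure_spmf.emeasure_eq_measure
      lossless_spmf_def weight_spmf_def)

lemma nn_integral_return_spmf [simp]: "nn_integral (measure_spmf (return_spmf x)) g = g x"
  by (simp add: measure_spmf_return_spmf nn_integral_return)

text \<open>Unfold the loop once: an accepted first draw costs one query, and a rejected one is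
  followed by a fresh run of the same loop with the count shifted by one. The integral after a
  rejection therefore does not depend on the rejected draw.\<close>

lemma nn_integral_draw_until:
  "(\<integral>\<^sup>+ x. g (snd x) \<partial>measure_spmf (draw_until D accept)) =
     g 1 * emeasure (measure_spmf D) {z. accept z} +
     (\<integral>\<^sup>+ x. g (Suc (snd x)) \<partial>measure_spmf (draw_until D accept)) *
       emeasure (measure_spmf D) {z. \<not> accept z}"
proof -
  let ?I = "\<integral>\<^sup>+ x. g (Suc (snd x)) \<partial>measure_spmf (draw_until D accept)"
  have "(\<integral>\<^sup>+ x. g (snd x) \<partial>measure_spmf (draw_until D accept)) =
      (\<integral>\<^sup>+ z. (if accept z then g 1 else ?I) \<partial>measure_spmf D)"
    by (subst draw_until.simps)
       (auto simp: nn_integral_bind_spmf case_prod_unfold intro!: nn_integral_cong)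
  also have "\<dots> = (\<integral>\<^sup>+ z. g 1 * indicator {z. accept z} z + ?I * indicator {z. \<not> accept z} z \<partial>measure_spmf D)"
    by (intro nn_integral_cong) auto
  also have "\<dots> = g 1 * emeasure (measure_spmf D) {z. accept z} +
      ?I * emeasure (measure_spmf D) {z. \<not> accept z}"
    by (subst nn_integral_add) (auto simp: nn_integral_cmult_indicator)
  finally show ?thesis .
qed

lemma emeasure_lossless_spmf_not:
  assumes "lossless_spmf D"
  shows "emeasure (measure_spmf D) {z. \<not> P z} = ennreal (1 - measure (measure_spmf D) {z. P z})"
proof -
  have "measure (measure_spmf D) (space (measure_spmf D) - {z. P z}) = 1 - measure (measure_spmf D) {z. P z}"
    using assms by (subst measure_spmf.finite_measure_compl)
      (auto simp: space_measure_spmf lossless_spmf_def weight_spmf_def)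
  moreover have "space (measure_spmf D) - {z. P z} = {z. \<not> P z}"
    by (auto simp: space_measure_spmf)
  ultimately show ?thesis
    by (simp add: measure_spmf.emeasure_eq_measure)
qed

text \<open>Applying the first-draw recursion to the constant function 1 gives
  \<open>w = p + w * (1 - p)\<close> for the total mass \<open>w\<close>, and \<open>p > 0\<close>
  forces \<open>w = 1\<close>.\<close>

lemma lossless_draw_until:
  assumes "lossless_spmf D" and "0 < measure (measure_spmf D) {z. accept z}"
  shows "lossless_spmf (draw_until D accept)"
proof -
  let ?p = "measure (measure_spmf D) {z. accept z}"
  let ?w = "weight_spmf (draw_until D accept)"
  have p1: "?p \<le> 1" by (rule measure_spmf.subprob_measure_le_1)
  have "ennreal ?w = ennreal ?p + ennreal ?w * ennreal (1 - ?p)"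
    using nn_integral_draw_until[where g = "\<lambda>_. 1" and D = D and accept = accept] emeasure_lossless_spmf_not[OF assms(1), of accept]
    by (simp add: space_measure_spmf measure_spmf.emeasure_eq_measure weight_spmf_def)
  also have "\<dots> = ennreal (?p + ?w * (1 - ?p))"
    using p1 by (simp add: ennreal_mult weight_spmf_nonneg)
  finally have "?w = ?p + ?w * (1 - ?p)"
    using p1 by (simp add: weight_spmf_nonneg del: ennreal_plus)
  then have "?p * (?w - 1) = 0" by (simp add: algebra_simps)
  then show ?thesis using assms(2) by (simp add: lossless_spmf_def)
qed

text \<open>The recursion for the moment generating function alone gives no bound, since infinity
  could also solve it. Hence the integrand is cut off to 0 from \<open>N\<close> on, the bound
  \<open>c\<close> is proved by induction on \<open>N\<close>, and monotone convergence removes the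
  cutoff.\<close>

lemma mgf_draw_until_le:
  fixes t p0 :: real
  assumes D: "lossless_spmf D" and p0: "p0 \<le> measure (measure_spmf D) {z. accept z}"
    and t: "0 \<le> t" "t < p0"
  shows "(\<integral>\<^sup>+ x. ennreal (exp (t * real (snd x))) \<partial>measure_spmf (draw_until D accept)) \<le> ennreal (p0 / (p0 - t))"
proof -
  define p where "p = measure (measure_spmf D) {z. accept z}"
  define c where "c = p0 / (p0 - t)"
  define f :: "nat \<Rightarrow> nat \<Rightarrow> ennreal" where "f N n = (if n < N then ennreal (exp (t * real n)) else 0)" for N n
  have p: "p0 \<le> p" "p \<le> 1" using p0 by (auto simp: p_def measure_spmf.subprob_measure_le_1)
  have accept: "emeasure (measure_spmf D) {z. accept z} = ennreal p"
    by (simp add: p_def measure_spmf.emeasure_eq_measure)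
  have reject: "emeasure (measure_spmf D) {z. \<not> accept z} = ennreal (1 - p)"
    unfolding p_def by (rule emeasure_lossless_spmf_not[OF D])
  have c: "0 \<le> c" using t by (simp add: c_def)
  \<comment> \<open>The quotient \<open>p / (p - t)\<close> decreases in \<open>p\<close>, so at the
    true acceptance probability it is at most \<open>c\<close>. This makes \<open>c\<close> a
    supersolution of the recursion, which is what the induction step needs.\<close>
  have "p * (p0 - t) \<le> p0 * (p - t)"
    using mult_right_mono[OF p(1) t(1)] by (simp add: algebra_simps)
  then have "p \<le> c * (p - t)"
    using t by (simp add: c_def field_simps)
  then have "p + (1 - p) * c \<le> (1 - t) * c" by (simp add: algebra_simps)
  also have "\<dots> \<le> exp (- t) * c"
    using exp_ge_add_one_self[of "- t"] c by (intro mult_right_mono) auto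
  finally have "exp t * (p + (1 - p) * c) \<le> exp t * (exp (- t) * c)"
    by (intro mult_left_mono) auto
  also have "\<dots> = c" by (simp add: exp_minus)
  finally have step: "exp t * (p + (1 - p) * c) \<le> c" .
  have bound: "(\<integral>\<^sup>+ x. f N (snd x) \<partial>measure_spmf (draw_until D accept)) \<le> ennreal c" for N
  proof (induction N)
    case 0
    then show ?case by (simp add: f_def)
  next
    case (Suc N)
    have shift: "f (Suc N) (Suc n) = ennreal (exp t) * f N n" for n
      by (simp add: f_def ring_distribs exp_add ennreal_mult)
    have "(\<integral>\<^sup>+ x. f (Suc N) (snd x) \<partial>measure_spmf (draw_until D accept)) =
        f (Suc N) 1 * ennreal p +
        ennreal (exp t) * (\<integral>\<^sup>+ x. f N (snd x) \<partial>measure_spmf (draw_until D accept)) * ennreal (1 - p)"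
      unfolding nn_integral_draw_until[where g = "f (Suc N)"] shift accept reject
      by (simp add: nn_integral_cmult del: One_nat_def)
    also have "\<dots> \<le> ennreal (exp t) * ennreal p + ennreal (exp t) * ennreal c * ennreal (1 - p)"
      by (intro add_mono mult_mono Suc.IH) (auto simp: f_def)
    also have "\<dots> = ennreal (exp t * p + exp t * c * (1 - p))"
      using p t c by (simp add: ennreal_mult)
    also have "\<dots> = ennreal (exp t * (p + (1 - p) * c))"
      by (simp add: algebra_simps)
    also have "\<dots> \<le> ennreal c" by (intro ennreal_leI step)
    finally show ?case .
  qed
  have "(\<integral>\<^sup>+ x. ennreal (exp (t * real (snd x))) \<partial>measure_spmf (draw_until D accept)) =
      (\<integral>\<^sup>+ x. (SUP N. f N (snd x)) \<partial>measure_spmf (draw_until D accept))"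
  proof (intro nn_integral_cong antisym)
    fix x :: "'a \<times> nat"
    show "ennreal (exp (t * real (snd x))) \<le> (SUP N. f N (snd x))"
      by (rule SUP_upper2[of "Suc (snd x)"]) (auto simp: f_def)
    show "(SUP N. f N (snd x)) \<le> ennreal (exp (t * real (snd x)))"
      by (rule SUP_least) (auto simp: f_def)
  qed
  also have "\<dots> = (SUP N. \<integral>\<^sup>+ x. f N (snd x) \<partial>measure_spmf (draw_until D accept))"
    by (intro nn_integral_monotone_convergence_SUP) (auto simp: incseq_def le_fun_def f_def)
  also have "\<dots> \<le> ennreal c" by (intro SUP_least bound)
  finally show ?thesis by (simp add: c_def)
qed

section \<open>Total query count of a sample and its upper tail\<close>

lemma lossless_draw_sample: "lossless_spmf P \<Longrightarrow> lossless_spmf (draw_sample m P)"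
  by (induction m) (auto simp: case_prod_unfold)

lemma mgf_draw_sample:
  "(\<integral>\<^sup>+ x. ennreal (exp (t * real (snd x))) \<partial>measure_spmf (draw_sample m P)) =
     (\<integral>\<^sup>+ x. ennreal (exp (t * real (snd x))) \<partial>measure_spmf P) ^ m"
proof (induction m)
  case (Suc m)
  then show ?case
    by (simp add: nn_integral_bind_spmf case_prod_unfold ring_distribs exp_add ennreal_mult
        nn_integral_cmult nn_integral_multc)
qed simp

text \<open>The difference of the two sides vanishes at 0 and has derivative
  \<open>u * (1 - u) / (2 * (1 + u))\<close>, which is nonnegative on the unit interval.\<close>

lemma ln_one_plus_le_quadratic:
  fixes x :: real
  assumes "0 \<le> x" "x \<le> 1"
  shows "ln (1 + x) \<le> x - x\<^sup>2 / 4"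
proof -
  have "x - x\<^sup>2 / 4 - ln (1 + x) \<ge> 0 - 0\<^sup>2 / 4 - ln (1 + 0)"
  proof (rule DERIV_nonneg_imp_nondecreasing[OF assms(1)])
    fix u :: real
    assume u: "0 \<le> u" "u \<le> x"
    have "((\<lambda>x. x - x\<^sup>2 / 4 - ln (1 + x)) has_real_derivative (1 - u / 2 - 1 / (1 + u))) (at u)"
      using u by (auto intro!: derivative_eq_intros)
    moreover have "1 - u / 2 - 1 / (1 + u) = u * (1 - u) / (2 * (1 + u))"
      using u by (simp add: field_simps)
    moreover have "\<dots> \<ge> 0" using u assms by auto
    ultimately show "\<exists>y. ((\<lambda>x. x - x\<^sup>2 / 4 - ln (1 + x)) has_real_derivative y) (at u) \<and> 0 \<le> y"
      by metis
  qed
  then show ?thesis by simp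
qed

lemma draw_sample_draw_until_tail:
  fixes p0 \<nu> :: real
  assumes D: "lossless_spmf D" and p0: "0 < p0" "p0 \<le> measure (measure_spmf D) {z. accept z}"
    and \<nu>: "0 < \<nu>" "\<nu> \<le> 1"
  shows "emeasure (measure_spmf (draw_sample m (draw_until D accept)))
           {x. real (snd x) > (1 + \<nu>) * (real m / p0)} \<le> ennreal (exp (- (\<nu>\<^sup>2 * real m / 4)))"
proof -
  let ?M = "measure_spmf (draw_sample m (draw_until D accept))"
  let ?K = "(1 + \<nu>) * (real m / p0)"
  \<comment> \<open>For positive \<open>m\<close> this \<open>t\<close> minimizes the Chernoff bound
    \<open>exp (- t * ?K) * (p0 / (p0 - t)) ^ m\<close>.\<close>
  define t where "t = p0 * \<nu> / (1 + \<nu>)"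
  have t: "0 < t" "t < p0" using p0 \<nu> by (auto simp: t_def field_simps)
  have ratio: "p0 / (p0 - t) = 1 + \<nu>"
    using p0 \<nu> by (simp add: t_def field_simps)
  have "emeasure ?M {x. real (snd x) > ?K} \<le> emeasure ?M {x\<in>UNIV. real (snd x) \<ge> ?K}"
    by (intro emeasure_mono) auto
  also have "\<dots> \<le> ennreal (exp (- t * ?K)) * (\<integral>\<^sup>+ x. ennreal (exp (t * real (snd x))) * indicator UNIV x \<partial>?M)"
    using t by (intro Chernoff_ineq_nn_integral_ge) auto
  also have "\<dots> \<le> ennreal (exp (- t * ?K)) * ennreal (1 + \<nu>) ^ m"
    using mgf_draw_until_le[OF D p0(2), of t] t
    by (intro mult_left_mono) (auto simp: mgf_draw_sample ratio intro!: power_mono)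
  also have "\<dots> = ennreal (exp (- t * ?K) * (1 + \<nu>) ^ m)"
    using \<nu> by (simp add: ennreal_power ennreal_mult del: ennreal_plus)
  also have "exp (- t * ?K) * (1 + \<nu>) ^ m = exp (real m * (ln (1 + \<nu>) - \<nu>))"
  proof -
    have "- t * ?K = - (real m * \<nu>)" using p0 \<nu> by (simp add: t_def)
    moreover have "(1 + \<nu>) ^ m = exp (real m * ln (1 + \<nu>))"
      using \<nu> by (simp add: exp_of_nat_mult)
    ultimately show ?thesis by (simp add: exp_add[symmetric] algebra_simps)
  qed
  also have "\<dots> \<le> exp (- (\<nu>\<^sup>2 * real m / 4))"
    using mult_left_mono[OF ln_one_plus_le_quadratic[of \<nu>], of "real m"] \<nu>
    by (simp add: algebra_simps)
  finally show ?thesis by (simp add: ennreal_leI)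
qed

section \<open>Proposal distributions and their acceptance probabilities\<close>

lemma near_pair_eq_spmf_of_set:
  assumes "finite X"
  shows "near_pair X d lam = spmf_of_set (SIGMA x:X. near X d lam x)"
proof (rule spmf_eqI)
  fix z :: "'a \<times> 'a"
  obtain x y where z: "z = (x, y)" by (cases z)
  let ?N = "near X d lam"
  let ?s = "\<Sum>z\<in>X. real (card (?N z))"
  define w where "w x = (if x \<in> X then real (card (?N x)) / ?s else 0)" for x
  have s: "0 \<le> ?s" by (simp add: sum_nonneg)
  have w0: "0 \<le> w x" for x using s by (simp add: w_def)
  have fin: "finite (?N x)" for x using assms by (simp add: near_def)
  have "(\<integral>\<^sup>+ x. ennreal (w x) \<partial>count_space UNIV) = (\<Sum>x\<in>X. ennreal (w x))"
    using assms by (intro nn_integral_count_space'[OF assms]) (auto simp: w_def)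
  also have "\<dots> = ennreal (\<Sum>x\<in>X. w x)" using w0 by simp
  \<comment> \<open>Without near pairs this quotient is 0 by the convention on division by zero, so
    only the bound by 1 holds in general.\<close>
  also have "(\<Sum>x\<in>X. w x) = ?s / ?s" by (simp add: w_def flip: sum_divide_distrib)
  also have "ennreal \<dots> \<le> 1" by simp
  finally have sub: "(\<integral>\<^sup>+ x. ennreal (w x) \<partial>count_space UNIV) \<le> 1" .
  have eq: "near_pair X d lam = embed_spmf w \<bind> (\<lambda>x. map_spmf (Pair x) (spmf_of_set (?N x)))"
    by (simp add: near_pair_def w_def[abs_def] map_spmf_conv_bind_spmf)
  have inner: "spmf (map_spmf (Pair x') (spmf_of_set (?N x'))) z =
      indicator (?N x) y / card (?N x) * indicator {x} x'" for x'
    using fin[of x'] by (auto simp: z spmf_of_set indicator_def inj_on_def card_image)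
  have "ennreal (spmf (near_pair X d lam) z) =
      (\<integral>\<^sup>+ x'. ennreal (indicator (?N x) y / card (?N x)) * indicator {x} x' \<partial>measure_spmf (embed_spmf w))"
    unfolding eq ennreal_spmf_bind inner
    by (intro nn_integral_cong) (auto simp: indicator_def)
  also have "\<dots> = ennreal (indicator (?N x) y / card (?N x)) * ennreal (w x)"
    using w0 by (simp add: nn_integral_cmult_indicator emeasure_spmf_single spmf_embed_spmf[OF sub])
  also have "\<dots> = ennreal (indicator (?N x) y / card (?N x) * w x)"
    using w0 by (intro ennreal_mult[symmetric]) auto
  finally have "spmf (near_pair X d lam) z = indicator (?N x) y / card (?N x) * w x"
    using w0 by (simp add: mult_nonneg_nonneg)
  \<comment> \<open>The weight of \<open>x\<close> cancels the uniform factor on its neighbours, so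
    every near pair gets mass \<open>1 / ?s\<close>. If \<open>?N x\<close> is empty, the indicator
    is 0 on both sides.\<close>
  also have "\<dots> = indicator (SIGMA x:X. ?N x) z / ?s"
    using fin[of x] by (auto simp: z w_def indicator_def card_eq_0_iff)
  also have "\<dots> = spmf (spmf_of_set (SIGMA x:X. ?N x)) z"
    using assms fin by (simp add: spmf_of_set)
  finally show "spmf (near_pair X d lam) z = spmf (spmf_of_set (SIGMA x:X. ?N x)) z" .
qed

lemma finite_distinct_pairs: "finite X \<Longrightarrow> finite (distinct_pairs X)"
  by (rule finite_subset[of _ "X \<times> X"]) (auto simp: distinct_pairs_def)

lemma distinct_pairs_nonempty:
  assumes "card X \<ge> 2"
  shows "distinct_pairs X \<noteq> {}"
proof -
  have "\<not> is_singleton X" using assms by (auto simp: is_singleton_altdef)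
  moreover have "X \<noteq> {}" using assms by auto
  ultimately obtain x y where "x \<in> X" "y \<in> X" "x \<noteq> y"
    by (metis is_singletonI')
  then show ?thesis by (auto simp: distinct_pairs_def)
qed

text \<open>Conditioning the uniform distribution on distance at most \<open>lam\<close> gives
  exactly the proposal distribution, so the second half of informativeness is a bound on its
  acceptance rate.\<close>

lemma near_pair_lossless_and_success:
  assumes X: "finite X" "card X \<ge> 2" and inf: "informative X d lam C \<alpha> \<beta>" and \<beta>: "0 < \<beta>"
  shows "lossless_spmf (near_pair X d lam)"
    and "\<beta> \<le> measure (measure_spmf (near_pair X d lam)) {p. same_cluster C p}"
proof -
  let ?D = "distinct_pairs X"
  let ?S = "SIGMA x:X. near X d lam x"
  have D: "finite ?D" "?D \<noteq> {}" using X by (auto simp: finite_distinct_pairs distinct_pairs_nonempty)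
  have near: "?D \<inter> {p. d (fst p) (snd p) \<le> lam} = ?S"
    by (auto simp: distinct_pairs_def near_def)
  have both: "?D \<inter> {p. same_cluster C p \<and> d (fst p) (snd p) \<le> lam} = ?S \<inter> {p. same_cluster C p}"
    unfolding near[symmetric] by auto
  have ratio: "\<beta> \<le> real (card (?S \<inter> {p. same_cluster C p})) / real (card ?S)"
    using inf D by (simp add: informative_def cond_prob_def U2_def measure_pmf_of_set near both)
  \<comment> \<open>Were there no near pairs, the ratio would be 0 by convention, contradicting
    \<beta> > 0.\<close>
  have "card ?S \<noteq> 0" using ratio \<beta> by (intro notI) (simp only: of_nat_0 div_by_0)
  then have S: "finite ?S" "?S \<noteq> {}" by (auto simp: card_eq_0_iff)
  show "lossless_spmf (near_pair X d lam)"
    using S by (simp add: near_pair_eq_spmf_of_set[OF X(1)])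
  show "\<beta> \<le> measure (measure_spmf (near_pair X d lam)) {p. same_cluster C p}"
    using ratio by (simp add: near_pair_eq_spmf_of_set[OF X(1)] measure_spmf_of_set)
qed

lemma measure_U2_not_same_cluster:
  "measure (measure_spmf (spmf_of_pmf (U2 X))) {p. \<not> same_cluster C p} = 1 - positive_prob X C"
  using measure_pmf.prob_neg[where P = "same_cluster C" and M = "U2 X"]
  by (simp add: positive_prob_def)

section \<open>Union bound over the two samples\<close>

theorem theorem17:
  fixes X :: "'a set" and d :: "'a \<Rightarrow> 'a \<Rightarrow> real"
    and F :: "'a set set set" and Cstar :: "'a set set"
    and lam \<epsilon> \<delta> \<alpha> \<beta> \<gamma> \<nu> w1 w2 a :: real
    and m_plus m_minus :: nat
  assumes "finite X" and "card X \<ge> 2" and "Metric_space X d"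
    and "\<And>C. C \<in> F \<Longrightarrow> partition_on X C" and "F \<noteq> {}"
    and "partition_on X Cstar"
    and "0 < \<epsilon>" and "\<epsilon> < 1" and "0 < \<delta>" and "\<delta> < 1"
    and "informative X d lam Cstar \<alpha> \<beta>" and "0 < \<beta>"
    and "skewed X Cstar \<gamma>" and "\<gamma> < 1"
    and "0 < a"
    and "real m_minus \<ge> a * ((real (clustering_vc_dim X F) + ln (2 / \<delta>)) / \<epsilon>\<^sup>2)"
    and "real m_plus \<ge> a * ((real (clustering_vc_dim X F) + ln (2 / \<delta>)) / \<epsilon>\<^sup>2)"
    and "0 < \<nu>" and "\<nu> \<le> 1"
  shows "measure (measure_spmf (ERM X d lam Cstar F w1 w2 m_plus m_minus))
           {(C, q). real q \<le> (1 + \<nu>) * (real m_minus / (1 - \<gamma>) + real m_plus / \<beta>)}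
         \<ge> 1 - exp (- (\<nu>\<^sup>2 * real m_minus / 4)) - exp (- (\<nu>\<^sup>2 * real m_plus / 4))"
proof -
  let ?P = "draw_sample m_plus (P11 X d lam Cstar)"
  let ?Q = "draw_sample m_minus (P0 X Cstar)"
  let ?E = "measure_spmf (ERM X d lam Cstar F w1 w2 m_plus m_minus)"
  let ?Kp = "(1 + \<nu>) * (real m_plus / \<beta>)"
  let ?Km = "(1 + \<nu>) * (real m_minus / (1 - \<gamma>))"
  let ?K = "(1 + \<nu>) * (real m_minus / (1 - \<gamma>) + real m_plus / \<beta>)"
  let ?ep = "exp (- (\<nu>\<^sup>2 * real m_plus / 4))"
  let ?em = "exp (- (\<nu>\<^sup>2 * real m_minus / 4))"
  note np = near_pair_lossless_and_success[OF assms(1,2,11,12)]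
  have neg: "1 - \<gamma> \<le> measure (measure_spmf (spmf_of_pmf (U2 X))) {p. \<not> same_cluster Cstar p}"
    using assms(13) unfolding measure_U2_not_same_cluster skewed_def by simp
  have lP: "lossless_spmf ?P"
    using np assms(12) unfolding P11_def by (intro lossless_draw_sample lossless_draw_until) auto
  have lQ: "lossless_spmf ?Q"
    using neg assms(14) unfolding P0_def by (intro lossless_draw_sample lossless_draw_until) auto
  \<comment> \<open>With no missing mass, an upper bound on the complementary event gives the
    required lower bound.\<close>
  have lE: "lossless_spmf (ERM X d lam Cstar F w1 w2 m_plus m_minus)"
    using lP lQ by (simp add: ERM_def case_prod_unfold)
  have tP: "emeasure (measure_spmf ?P) {x. real (snd x) > ?Kp} \<le> ennreal ?ep"
    unfolding P11_def using np assms(12,18,19) by (intro draw_sample_draw_until_tail) auto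
  have tQ: "emeasure (measure_spmf ?Q) {x. real (snd x) > ?Km} \<le> ennreal ?em"
    unfolding P0_def using neg assms(14,18,19) by (intro draw_sample_draw_until_tail) auto
  have K: "?K = ?Km + ?Kp" by (simp add: algebra_simps)
  have "emeasure ?E {x. \<not> real (snd x) \<le> ?K} =
      (\<integral>\<^sup>+ x. indicator {x. \<not> real (snd x) \<le> ?K} x \<partial>?E)"
    by simp
  also have "\<dots> = (\<integral>\<^sup>+ x. \<integral>\<^sup>+ y. indicator {n. \<not> real n \<le> ?K} (snd x + snd y) \<partial>measure_spmf ?Q \<partial>measure_spmf ?P)"
    unfolding ERM_def
    by (simp add: nn_integral_bind_spmf case_prod_unfold indicator_def del: nn_integral_indicator)
  \<comment> \<open>If neither count exceeds its own share of \<open>?K\<close>, the sum does not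
    exceed \<open>?K\<close>.\<close>
  also have "\<dots> \<le> (\<integral>\<^sup>+ x. \<integral>\<^sup>+ y. indicator {x. real (snd x) > ?Kp} x + indicator {y. real (snd y) > ?Km} y
      \<partial>measure_spmf ?Q \<partial>measure_spmf ?P)"
    unfolding K by (intro nn_integral_mono) (auto simp: indicator_def)
  \<comment> \<open>Each indicator is constant in the other sample, whose total mass is 1.\<close>
  also have "\<dots> = emeasure (measure_spmf ?P) {x. real (snd x) > ?Kp} +
      emeasure (measure_spmf ?Q) {y. real (snd y) > ?Km}"
    using lP lQ by (simp add: nn_integral_add emeasure_space_lossless_spmf nn_integral_multc)
  also have "\<dots> \<le> ennreal (?ep + ?em)" using tP tQ by (simp add: add_mono)
  finally have "1 - measure ?E {x. real (snd x) \<le> ?K} \<le> ?ep + ?em"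
    unfolding emeasure_lossless_spmf_not[OF lE] by (simp del: ennreal_plus)
  then show ?thesis by (simp add: case_prod_unfold)
qed

end
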